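(* Let $n,d\ge 1$ and let $M$ be a quadratic module in $\mathbb{R}[X]$. Then $M$ is Archimedean if and only if $M^n$ is an Archimedean quadratic module in $\mathcal{M}_n(\mathbb{R}[X])$.
   Context: $\mathbb{R}[X]=\mathbb{R}[x_1,\dots,x_d]$. $\mathcal{M}_n(\mathbb{R}[X])$ is the ring of $n\times n$ matrices over $\mathbb{R}[X]$, $\mathcal{S}_n(\mathbb{R}[X])$ its subset of symmetric matrices, $\mathbf{I}_n$ the identity matrix. A quadratic module in $\mathcal{M}_n(\mathbb{R}[X])$ is a set $\mathcal{M}\subseteq\mathcal{S}_n(\mathbb{R}[X])$ with $\mathbf{I}_n\in\mathcal{M}$, $\mathcal{M}+\mathcal{M}\subseteq\mathcal{M}$, and $A^T\mathcal{M}A\subseteq\mathcal{M}$ for all $A\in\mathcal{M}_n(\mathbb{R}[X])$; a quadratic module in $\mathbb{R}[X]$ is the case $n=1$ (contains $1$, closed under addition and under multiplication by squares $a^2$, $a\in\mathbb{R}[X]$). A quadratic module $\mathcal{M}$ in $\mathcal{M}_n(\mathbb{R}[X])$ is Archimedean if for each $\mathbf{A}\in\mathcal{M}_n(\mathbb{R}[X])$ there is $k\in\mathbb{N}$ such that $k\cdot\mathbf{I}_n-\mathbf{A}^T\mathbf{A}\in\mathcal{M}$ (for $n=1$: for each $a\in\mathbb{R}[X]$ there is $k\in\mathbb{N}$ with $k-a^2\in M$). For a quadratic module $M$ in $\mathbb{R}[X]$, $M^n$ denotes the set of all finite sums $\sum_i m_iA_i^TA_i$ with $m_i\in M$, $A_i\in\mathcal{M}_n(\mathbb{R}[X])$;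 it is a quadratic module in $\mathcal{M}_n(\mathbb{R}[X])$. *)

theory Defs
  imports "HOL-Analysis.Analysis" "HOL-Library.Poly_Mapping"
begin

text \<open>Real polynomials in indeterminates indexed by \<open>'d\<close>: finitely supported maps from exponent
  vectors to coefficients, with the convolution product of \<^theory>\<open>HOL-Library.Poly_Mapping\<close>.
  For a finite index type \<open>'d\<close> this is $R[x_1,...,x_d]$ with $d$ = \<open>CARD('d)\<close>.\<close>

type_synonym 'd rpoly = "('d \<Rightarrow>\<^sub>0 nat) \<Rightarrow>\<^sub>0 real"

definition quadratic_module :: "'a::comm_ring_1 set \<Rightarrow> bool" where
  "quadratic_module M \<longleftrightarrow>
     1 \<in> M \<and> (\<forall>x\<in>M. \<forall>y\<in>M. x + y \<in> M) \<and> (\<forall>a. \<forall>x\<in>M. a\<^sup>2 * x \<in> M)"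

definition archimedean :: "'a::comm_ring_1 set \<Rightarrow> bool" where
  "archimedean M \<longleftrightarrow> (\<forall>a. \<exists>k::nat. of_nat k - a\<^sup>2 \<in> M)"

definition matrix_quadratic_module :: "('a::comm_ring_1 ^ 'n ^ 'n) set \<Rightarrow> bool" where
  "matrix_quadratic_module \<M> \<longleftrightarrow>
     \<M> \<subseteq> {A. transpose A = A} \<and> mat 1 \<in> \<M> \<and>
     (\<forall>B\<in>\<M>. \<forall>C\<in>\<M>. B + C \<in> \<M>) \<and>
     (\<forall>A :: 'a ^ 'n ^ 'n. \<forall>B\<in>\<M>. transpose A ** B ** A \<in> \<M>)"

text \<open>\<open>mat c\<close> is the scalar matrix \<open>c\<close> times the identity.\<close>

definition matrix_archimedean :: "('a::comm_ring_1 ^ 'n ^ 'n) set \<Rightarrow> bool" where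
  "matrix_archimedean \<M> \<longleftrightarrow> (\<forall>A :: 'a ^ 'n ^ 'n. \<exists>k::nat. mat (of_nat k) - transpose A ** A \<in> \<M>)"

definition matrix_extension :: "'a::comm_ring_1 set \<Rightarrow> ('a ^ 'n ^ 'n) set" where
  "matrix_extension M =
     {\<Sum>i<N. mat (m i) ** (transpose (A i) ** A i) | (N::nat) m (A :: nat \<Rightarrow> 'a ^ 'n ^ 'n). \<forall>i<N. m i \<in> M}"

end

theory Submission
  imports Defs
begin

text \<open>
  If \<open>M\<close> is Archimedean, the matrices \<open>A\<close> for which some \<open>k I - A\<^sup>T A\<close> lies in \<open>M\<^sup>n\<close> contain every
  matrix with a single nonzero entry, because then \<open>k I - A\<^sup>T A\<close> is diagonal with entries in \<open>M\<close>.
  They are closed under addition by the parallelogram identity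
  \<open>2 (A\<^sup>T A + B\<^sup>T B) - (A + B)\<^sup>T (A + B) = (A - B)\<^sup>T (A - B)\<close>, hence exhaust all matrices.
  Conversely, the diagonal entries of a member of \<open>M\<^sup>n\<close> lie in \<open>M\<close>, and a diagonal entry of
  \<open>k I - (a I)\<^sup>T (a I)\<close> is \<open>k - a\<^sup>2\<close>.
\<close>

section \<open>Closure properties of scalar quadratic modules\<close>

lemma quadratic_module_zero:
  assumes "quadratic_module M"
  shows "0 \<in> M"
proof -
  have "0\<^sup>2 * 1 \<in> M"
    using assms unfolding quadratic_module_def by blast
  then show ?thesis by simp
qed

text \<open>Over an infinite index set the sum is 0 by convention, so membership of 0 settles that
  case as well as the empty one.\<close>

lemma quadratic_module_sum:
  assumes "quadratic_module M" and "\<And>i. i \<in> I \<Longrightarrow> f i \<in> M"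
  shows "sum f I \<in> M"
  using assms(2)
  by (induction I rule: infinite_finite_induct)
    (use assms(1) in \<open>auto simp: quadratic_module_zero quadratic_module_def\<close>)

lemma quadratic_module_of_nat:
  assumes "quadratic_module M"
  shows "of_nat k \<in> M"
  by (induction k)
    (use assms in \<open>auto simp: quadratic_module_zero quadratic_module_def\<close>)

section \<open>Entries of scalar multiples and Gram matrices\<close>

lemma mat_mult_nth:
  fixes A :: "'a::comm_ring_1 ^ 'n ^ 'n"
  shows "(mat c ** A) $ p $ q = c * A $ p $ q"
proof -
  have "(mat c ** A) $ p $ q = (\<Sum>s\<in>UNIV. if s = p then c * A $ s $ q else 0)"
    unfolding matrix_matrix_mult_def mat_def vec_lambda_beta by (rule sum.cong) auto
  then show ?thesis by simp
qed

lemma mult_mat_nth: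
  fixes A :: "'a::comm_ring_1 ^ 'n ^ 'n"
  shows "(A ** mat c) $ p $ q = A $ p $ q * c"
proof -
  have "(A ** mat c) $ p $ q = (\<Sum>s\<in>UNIV. if s = q then A $ p $ s * c else 0)"
    unfolding matrix_matrix_mult_def mat_def vec_lambda_beta by (rule sum.cong) auto
  then show ?thesis by simp
qed

lemma mat_mult_commute:
  fixes A :: "'a::comm_ring_1 ^ 'n ^ 'n"
  shows "A ** mat c = mat c ** A"
  by (simp add: vec_eq_iff mat_mult_nth mult_mat_nth mult.commute)

lemma gram_nth:
  fixes A :: "'a::comm_ring_1 ^ 'n ^ 'm"
  shows "(transpose A ** A) $ p $ q = (\<Sum>r\<in>UNIV. A $ r $ p * A $ r $ q)"
  by (simp add: matrix_matrix_mult_def transpose_def)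

text \<open>Concatenates two families of summands, as needed to add two members of
  \<open>matrix_extension M\<close>, whose sums run over initial segments of the naturals.\<close>

lemma sum_lessThan_append:
  fixes f g :: "nat \<Rightarrow> 'a::comm_monoid_add"
  shows "(\<Sum>i<N. f i) + (\<Sum>i<N'. g i) = (\<Sum>i<N + N'. if i < N then f i else g (i - N))"
  by (induction N') (auto simp flip: add.assoc)

section \<open>The matrix extension is a quadratic module\<close>

lemma matrix_extension_zero: "0 \<in> matrix_extension M"
  unfolding matrix_extension_def by (auto intro!: exI[of _ "0::nat"])

lemma matrix_extension_gram:
  fixes A :: "'a::comm_ring_1 ^ 'n ^ 'n"
  assumes "c \<in> M"
  shows "mat c ** (transpose A ** A) \<in> matrix_extension M"
  unfolding matrix_extension_def using assms
  by (auto intro!: exI[of _ "1::nat"] exI[of _ "\<lambda>_. c"] exI[of _ "\<lambda>_. A"])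

lemma matrix_extension_add:
  fixes B C :: "'a::comm_ring_1 ^ 'n ^ 'n"
  assumes "B \<in> matrix_extension M" and "C \<in> matrix_extension M"
  shows "B + C \<in> matrix_extension M"
proof -
  from assms(1) obtain N :: nat and m and A :: "nat \<Rightarrow> 'a ^ 'n ^ 'n"
    where B: "B = (\<Sum>i<N. mat (m i) ** (transpose (A i) ** A i))"
    and m: "\<forall>i<N. m i \<in> M"
    unfolding matrix_extension_def by blast
  from assms(2) obtain N' :: nat and m' and A' :: "nat \<Rightarrow> 'a ^ 'n ^ 'n"
    where C: "C = (\<Sum>i<N'. mat (m' i) ** (transpose (A' i) ** A' i))"
    and m': "\<forall>i<N'. m' i \<in> M"
    unfolding matrix_extension_def by blast
  let ?m = "\<lambda>i. if i < N then m i else m' (i - N)"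
  let ?A = "\<lambda>i. if i < N then A i else A' (i - N)"
  have "B + C = (\<Sum>i<N + N'. mat (?m i) ** (transpose (?A i) ** ?A i))"
    unfolding B C sum_lessThan_append by (rule sum.cong) auto
  moreover have "\<forall>i<N + N'. ?m i \<in> M"
    using m m' by auto
  ultimately show ?thesis
    unfolding matrix_extension_def mem_Collect_eq
    by (intro exI[of _ "N + N'"] exI[of _ ?m] exI[of _ ?A] conjI)
qed

lemma matrix_extension_sum:
  assumes "\<And>i. i \<in> I \<Longrightarrow> f i \<in> matrix_extension M"
  shows "sum f I \<in> matrix_extension M"
  using assms
  by (induction I rule: infinite_finite_induct)
    (auto simp: matrix_extension_zero matrix_extension_add)

text \<open>Reduces additive properties of the extension to its generators c A^T A, by induction on
  the number of summands.\<close>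

lemma matrix_extension_induct [consumes 1, case_names zero gram add]:
  fixes B :: "'a::comm_ring_1 ^ 'n ^ 'n"
  assumes "B \<in> matrix_extension M"
    and "P 0"
    and "\<And>c (A :: 'a ^ 'n ^ 'n). c \<in> M \<Longrightarrow> P (mat c ** (transpose A ** A))"
    and "\<And>B C. P B \<Longrightarrow> P C \<Longrightarrow> P (B + C)"
  shows "P B"
proof -
  obtain N :: nat and m and A :: "nat \<Rightarrow> 'a ^ 'n ^ 'n"
    where B: "B = (\<Sum>i<N. mat (m i) ** (transpose (A i) ** A i))" and m: "\<forall>i<N. m i \<in> M"
    using assms(1) unfolding matrix_extension_def by blast
  show ?thesis
    unfolding B using m by (induction N) (auto intro: assms(2-4))
qed

lemma matrix_extension_symmetric:
  fixes B :: "'a::comm_ring_1 ^ 'n ^ 'n"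
  assumes "B \<in> matrix_extension M"
  shows "transpose B = B"
  using assms
proof (induction rule: matrix_extension_induct)
  case (gram c A)
  \<comment> \<open>Transposing reverses the product and moves the scalar to the right; scalar
    matrices are central, so it can be moved back.\<close>
  have "transpose (mat c ** (transpose A ** A)) = transpose A ** A ** mat c"
    unfolding matrix_transpose_mul transpose_mat transpose_transpose ..
  then show ?case
    unfolding mat_mult_commute .
qed (simp_all add: transpose_def vec_eq_iff)

lemma matrix_add_rdistrib:
  fixes A B :: "'a::semiring_1 ^ 'n ^ 'm"
  shows "(A + B) ** C = A ** C + B ** C"
  by (simp add: vec_eq_iff matrix_matrix_mult_def distrib_right sum.distrib)

text \<open>Centrality of scalars gives A^T (c C^T C) A = c (C A)^T (C A), again a generator;
  congruence is additive in the middle factor.\<close>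

lemma matrix_extension_congruence:
  fixes A B :: "'a::comm_ring_1 ^ 'n ^ 'n"
  assumes "B \<in> matrix_extension M"
  shows "transpose A ** B ** A \<in> matrix_extension M"
  using assms
proof (induction rule: matrix_extension_induct)
  case (gram c C)
  have "transpose A ** (mat c ** (transpose C ** C)) ** A =
      (transpose A ** mat c) ** (transpose C ** C) ** A"
    by (simp only: matrix_mul_assoc)
  also have "\<dots> = (mat c ** transpose A) ** (transpose C ** C) ** A"
    by (simp only: mat_mult_commute[of "transpose A"])
  also have "\<dots> = mat c ** (transpose (C ** A) ** (C ** A))"
    by (simp only: matrix_mul_assoc matrix_transpose_mul)
  also have "\<dots> \<in> matrix_extension M"
    using gram by (rule matrix_extension_gram)
  finally show ?case .
next
  case zero
  have "transpose A ** 0 ** A = 0"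
    by (simp add: vec_eq_iff matrix_matrix_mult_def)
  then show ?case
    by (simp add: matrix_extension_zero)
next
  case (add B C)
  then show ?case
    by (simp add: matrix_add_ldistrib matrix_add_rdistrib matrix_extension_add)
qed

lemma matrix_quadratic_module_extension:
  fixes M :: "'a::comm_ring_1 set"
  assumes "quadratic_module M"
  shows "matrix_quadratic_module (matrix_extension M :: ('a ^ 'n ^ 'n) set)"
proof -
  have "1 \<in> M"
    using assms unfolding quadratic_module_def by blast
  from matrix_extension_gram[OF this, of "mat 1"]
  have "mat 1 \<in> (matrix_extension M :: ('a ^ 'n ^ 'n) set)"
    by (simp add: transpose_mat)
  then show ?thesis
    unfolding matrix_quadratic_module_def
    by (simp add: subset_iff matrix_extension_symmetric matrix_extension_add
        matrix_extension_congruence)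
qed

text \<open>For a generator c A^T A the entry is c times the sum of squares of column
  \<open>p\<close> of A, and each such square times c stays in \<open>M\<close>.\<close>

lemma matrix_extension_diagonal_entry:
  assumes "quadratic_module M" and "B \<in> matrix_extension M"
  shows "B $ p $ p \<in> M"
  using assms(2)
proof (induction rule: matrix_extension_induct)
  case (gram c A)
  have "(\<Sum>r\<in>UNIV. (A $ r $ p)\<^sup>2 * c) \<in> M"
    using assms(1) gram by (intro quadratic_module_sum) (auto simp: quadratic_module_def)
  then show ?case
    unfolding mat_mult_nth gram_nth by (simp add: sum_distrib_left power2_eq_square mult_ac)
qed (use assms(1) in \<open>auto simp: quadratic_module_zero quadratic_module_def\<close>)

section \<open>Single-entry and diagonal matrices\<close>

definition single_entry :: "'n \<Rightarrow> 'n \<Rightarrow> 'a::comm_ring_1 \<Rightarrow> 'a ^ 'n ^ 'n" where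
  "single_entry i j a = (\<chi> p q. if p = i \<and> q = j then a else 0)"

lemma matrix_eq_sum_single_entry:
  fixes A :: "'a::comm_ring_1 ^ 'n ^ 'n"
  shows "A = (\<Sum>i\<in>UNIV. \<Sum>j\<in>UNIV. single_entry i j (A $ i $ j))"
proof -
  \<comment> \<open>The joint condition on the position is split into two nested ones, so that each
    sum collapses separately.\<close>
  have "(\<Sum>i\<in>UNIV. \<Sum>j\<in>UNIV. single_entry i j (A $ i $ j)) $ p $ q =
      (\<Sum>i\<in>UNIV. if i = p then (\<Sum>j\<in>UNIV. if j = q then A $ i $ j else 0) else 0)" for p q
    unfolding sum_component single_entry_def vec_lambda_beta by (rule sum.cong) auto
  then show ?thesis by (simp add: vec_eq_iff)
qed

lemma single_entry_gram_nth:
  fixes a :: "'a::comm_ring_1"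
  shows "(transpose (single_entry i j a) ** single_entry i j a) $ p $ q =
    (if p = j \<and> q = j then a\<^sup>2 else 0)"
proof -
  have "(transpose (single_entry i j a) ** single_entry i j a) $ p $ q =
      (\<Sum>r\<in>UNIV. if r = i then (if p = j \<and> q = j then a\<^sup>2 else 0) else 0)"
    unfolding gram_nth single_entry_def vec_lambda_beta
    by (rule sum.cong) (auto simp: power2_eq_square)
  then show ?thesis by simp
qed

text \<open>The Gram matrix of the unit \<open>?E l\<close> is the projection onto coordinate l, so
  the diagonal matrix is the sum of these projections weighted by \<open>c l\<close>.\<close>

lemma diagonal_in_matrix_extension:
  fixes c :: "'n::finite \<Rightarrow> 'a::comm_ring_1"
  assumes "\<And>p. c p \<in> M"
  shows "(\<chi> p q. if p = q then c p else 0) \<in> matrix_extension M"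
proof -
  let ?E = "\<lambda>l. single_entry l l (1::'a)"
  have "(\<Sum>l\<in>UNIV. mat (c l) ** (transpose (?E l) ** ?E l)) $ p $ q =
      (\<Sum>l\<in>UNIV. if l = p then (if p = q then c p else 0) else 0)" for p q
    unfolding sum_component mat_mult_nth single_entry_gram_nth by (rule sum.cong) auto
  then have "(\<chi> p q. if p = q then c p else 0) =
      (\<Sum>l\<in>UNIV. mat (c l) ** (transpose (?E l) ** ?E l))"
    by (simp add: vec_eq_iff)
  also have "\<dots> \<in> matrix_extension M"
    by (intro matrix_extension_sum matrix_extension_gram assms)
  finally show ?thesis .
qed

section \<open>Bounded elements and the Archimedean property\<close>

definition bounded_elements :: "('a::comm_ring_1 ^ 'n ^ 'n) set \<Rightarrow> ('a ^ 'n ^ 'n) set" where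
  "bounded_elements \<M> = {A. \<exists>k::nat. mat (of_nat k) - transpose A ** A \<in> \<M>}"

lemma matrix_archimedean_iff: "matrix_archimedean \<M> \<longleftrightarrow> bounded_elements \<M> = UNIV"
  unfolding matrix_archimedean_def bounded_elements_def by auto

lemma bounded_elements_add:
  fixes \<M> :: "('a::comm_ring_1 ^ 'n ^ 'n) set"
  assumes \<M>: "matrix_quadratic_module \<M>"
    and "A \<in> bounded_elements \<M>" and "B \<in> bounded_elements \<M>"
  shows "A + B \<in> bounded_elements \<M>"
proof -
  obtain k l :: nat
    where k: "mat (of_nat k) - transpose A ** A \<in> \<M>" (is "?K \<in> _")
      and l: "mat (of_nat l) - transpose B ** B \<in> \<M>" (is "?L \<in> _")
    using assms unfolding bounded_elements_def by blast
  have add: "C + D \<in> \<M>" if "C \<in> \<M>" "D \<in> \<M>" for C D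
    using \<M> that unfolding matrix_quadratic_module_def by blast
  \<comment> \<open>Gram matrices are congruences of the identity.\<close>
  have "transpose (A - B) ** mat 1 ** (A - B) \<in> \<M>"
    using \<M> unfolding matrix_quadratic_module_def by blast
  then have D: "transpose (A - B) ** (A - B) \<in> \<M>" by simp
  \<comment> \<open>The bound 2(k + l) comes from the parallelogram identity; doubling is written as
    repeated addition to match closure of the module under sums.\<close>
  have "mat (of_nat (k + k + l + l)) - transpose (A + B) ** (A + B) =
      ?K + ?K + (?L + ?L) + transpose (A - B) ** (A - B)"
    by (simp add: vec_eq_iff mat_def matrix_matrix_mult_def transpose_def
        algebra_simps sum.distrib sum_subtractf)
  also have "\<dots> \<in> \<M>"
    by (intro add k l D)
  finally show ?thesis
    unfolding bounded_elements_def by blast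
qed

text \<open>The induction starts from singletons, where boundedness is the assumption
  itself.\<close>

lemma bounded_elements_sum:
  assumes "matrix_quadratic_module \<M>" and "finite I" and "I \<noteq> {}"
    and "\<And>i. i \<in> I \<Longrightarrow> f i \<in> bounded_elements \<M>"
  shows "sum f I \<in> bounded_elements \<M>"
  using assms(2-4)
  by (induction I rule: finite_ne_induct) (auto intro: bounded_elements_add[OF assms(1)])

lemma single_entry_bounded:
  fixes M :: "'a::comm_ring_1 set" and i j :: "'n::finite"
  assumes "quadratic_module M" and "archimedean M"
  shows "single_entry i j a \<in> bounded_elements (matrix_extension M)"
proof -
  obtain k :: nat where k: "of_nat k - a\<^sup>2 \<in> M"
    using assms(2) unfolding archimedean_def by blast
  \<comment> \<open>The Gram matrix has its only possibly nonzero entry, a^2, at position (j, j);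
    the other diagonal entries remain k, which is a sum of ones and so in \<open>M\<close>.\<close>
  let ?c = "\<lambda>p. if p = j then of_nat k - a\<^sup>2 else of_nat k"
  have "mat (of_nat k) - transpose (single_entry i j a) ** single_entry i j a =
      (\<chi> p q. if p = q then ?c p else 0)"
    by (auto simp: vec_eq_iff single_entry_gram_nth mat_def)
  also have "\<dots> \<in> matrix_extension M"
    by (rule diagonal_in_matrix_extension)
      (use assms(1) k in \<open>auto simp: quadratic_module_of_nat\<close>)
  finally show ?thesis
    unfolding bounded_elements_def by blast
qed

lemma matrix_archimedean_extension:
  fixes M :: "'a::comm_ring_1 set"
  assumes "quadratic_module M" and "archimedean M"
  shows "matrix_archimedean (matrix_extension M :: ('a ^ 'n ^ 'n) set)"
proof -
  note qm = matrix_quadratic_module_extension[OF assms(1)]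
  have "A \<in> bounded_elements (matrix_extension M)" for A :: "'a ^ 'n ^ 'n"
    by (subst matrix_eq_sum_single_entry)
      (intro bounded_elements_sum[OF qm] single_entry_bounded assms; simp)
  then show ?thesis
    unfolding matrix_archimedean_iff by blast
qed

lemma archimedean_of_matrix_archimedean:
  fixes M :: "'a::comm_ring_1 set"
  assumes "quadratic_module M"
    and "matrix_archimedean (matrix_extension M :: ('a ^ 'n ^ 'n) set)"
  shows "archimedean M"
  unfolding archimedean_def
proof
  fix a :: 'a
  obtain k :: nat
    where "mat (of_nat k) - transpose (mat a) ** mat a \<in> (matrix_extension M :: ('a ^ 'n ^ 'n) set)"
    using assms(2) unfolding matrix_archimedean_def by blast
  from matrix_extension_diagonal_entry[OF assms(1) this]
  \<comment> \<open>A scalar matrix is its own transpose. Any \<open>p\<close> serves below, since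
    the index type is inhabited.\<close>
  have "of_nat k - (mat a ** (mat a :: 'a ^ 'n ^ 'n)) $ p $ p \<in> M" for p
    by (simp add: transpose_mat) (simp add: mat_def)
  moreover have "(mat a ** (mat a :: 'a ^ 'n ^ 'n)) $ p $ p = a\<^sup>2" for p
    by (simp add: mat_mult_nth power2_eq_square) (simp add: mat_def)
  ultimately show "\<exists>k::nat. of_nat k - a\<^sup>2 \<in> M" by auto
qed

theorem proposition5p4:
  fixes M :: "'d::finite rpoly set"
  assumes "quadratic_module M"
  shows "archimedean M \<longleftrightarrow>
    matrix_quadratic_module (matrix_extension M :: ('d rpoly ^ 'n::finite ^ 'n) set) \<and>
    matrix_archimedean (matrix_extension M :: ('d rpoly ^ 'n ^ 'n) set)"
  using assms matrix_quadratic_module_extension matrix_archimedean_extension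
    archimedean_of_matrix_archimedean by blast

end
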